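(* Let $G$ be a connected graph on $n\ge 2$ vertices, with vertex degrees $d_1\ge d_2\ge\cdots\ge d_n$ and Laplacian eigenvalues $\lambda_1\ge\lambda_2\ge\cdots\ge\lambda_n(=0)$. Then the edge-connectivity $\kappa_e(G)$ satisfies $$\kappa_e(G)\;\le\;\min_{0<m<n}\left\{(n-m)\sum_{i=1}^{m}(\lambda_i-d_i)\right\},$$ where the minimum is over integers $m$.
   Context: All graphs are finite and simple. The Laplacian eigenvalues of $G=(V,E)$ are the eigenvalues (with multiplicity) of $L=D-A$, where $D$ is the diagonal matrix of vertex degrees and $A$ is the adjacency matrix. For a vertex subset $U\subset V$ with $0<|U|<n$ and $\overline{U}=V\setminus U$, the set $\partial(U,\overline{U})$ of edges connecting a vertex of $U$ with a vertex of $\overline{U}$ is called a cut. The edge-connectivity $\kappa_e(G)$ is the minimum size of a cut in $G$. *)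

theory Defs
  imports
    "Graph_Theory.Digraph_Component"
    "Jordan_Normal_Form.Char_Poly"
    "HOL-Library.Multiset"
begin

text \<open>
  A finite simple graph is a member of the locale \<open>graph\<close> of the AFP library on graph theory: a finite, loop-free
  digraph without parallel arcs whose arc relation is symmetric.  Each undirected edge is thus a
  pair of opposite arcs, and the degree of a vertex is its \<open>out_degree\<close>.
\<close>

definition degree_matrix :: "('a, 'b) pre_digraph \<Rightarrow> 'a list \<Rightarrow> real mat" where
  "degree_matrix G vs = mat (length vs) (length vs)
     (\<lambda>(i, j). if i = j then real (out_degree G (vs ! i)) else 0)"

definition adjacency_matrix :: "('a, 'b) pre_digraph \<Rightarrow> 'a list \<Rightarrow> real mat" where
  "adjacency_matrix G vs = mat (length vs) (length vs)
     (\<lambda>(i, j). if vs ! i \<rightarrow>\<^bsub>G\<^esub> vs ! j then 1 else 0)"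

text \<open>
  Rows and columns are indexed by the positions in \<open>vs\<close>, which is meant to list every vertex of
  \<open>G\<close> exactly once.
\<close>

definition laplacian_matrix :: "('a, 'b) pre_digraph \<Rightarrow> 'a list \<Rightarrow> real mat" where
  "laplacian_matrix G vs = degree_matrix G vs - adjacency_matrix G vs"

text \<open>
  The two lists below are in non-increasing order with repetitions.  List positions start at 0, so
  the i-th largest entry is at position \<open>i - 1\<close>.  The Laplacian matrix is real symmetric, so the
  real roots of its characteristic polynomial, taken with multiplicity, are all of its eigenvalues.
\<close>

definition laplacian_eigenvalues :: "('a, 'b) pre_digraph \<Rightarrow> 'a list \<Rightarrow> real list" where
  "laplacian_eigenvalues G vs =
     rev (sorted_list_of_multiset (proots (char_poly (laplacian_matrix G vs))))"

definition degree_sequence :: "('a, 'b) pre_digraph \<Rightarrow> nat list" where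
  "degree_sequence G =
     rev (sorted_list_of_multiset (image_mset (out_degree G) (mset_set (verts G))))"

text \<open>A cut consists of undirected edges, i.e. two-element sets of adjacent vertices.\<close>

definition cut :: "('a, 'b) pre_digraph \<Rightarrow> 'a set \<Rightarrow> 'a set set" where
  "cut G U = {{u, v} | u v. u \<in> U \<and> v \<in> verts G - U \<and> u \<rightarrow>\<^bsub>G\<^esub> v}"

definition edge_connectivity :: "('a, 'b) pre_digraph \<Rightarrow> nat" where
  "edge_connectivity G =
     Min {card (cut G U) | U. U \<subseteq> verts G \<and> 0 < card U \<and> card U < card (verts G)}"

end

theory Submission
  imports Defs "Jordan_Normal_Form.Schur_Decomposition"
begin

text \<open>
  For any set \<open>U\<close> of \<open>m\<close> vertices with \<open>0 < m < n\<close>, the \<open>m\<close> largest eigenvalues of the Laplacian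
  matrix \<open>L\<close> have sum at least \<open>(\<Sum>u\<in>U. d(u)) + c / (n - m)\<close>, where \<open>c\<close> is the size of the cut
  between \<open>U\<close> and its complement.  Since \<open>c\<close> is at least the edge-connectivity, taking \<open>m\<close> vertices of
  largest degree for \<open>U\<close> and multiplying by \<open>n - m\<close> gives the claim.

  To see the inequality, consider the subspace of dimension \<open>m + 1\<close> spanned by the unit vectors of the
  vertices in \<open>U\<close> and by the indicator vector of the complement of \<open>U\<close>.  These vectors are orthogonal,
  and the trace of the compression of \<open>L\<close> to their span is the sum of the degrees in \<open>U\<close>, from the
  unit vectors, plus \<open>c / (n - m)\<close>, from the normalized indicator vector.  The span contains the
  all-ones vector, which \<open>L\<close> annihilates.  So only the \<open>m\<close>-dimensional orthogonal complement of this
  vector in the span contributes to the trace, and by Ky Fan's principle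
  (\<open>ky_fan_projection_trace_le\<close>) the trace of a compression to \<open>m\<close> dimensions is at most the sum of
  the \<open>m\<close> largest eigenvalues.  The lemma \<open>mat_trace_mult_zero_sum_projection\<close> computes the trace for
  any square matrix with zero row sums, and \<open>largest_eigenvalues_ge_diagonal_plus_cut\<close> combines
  the two.

  Ky Fan's principle rests on \<open>real_spectral_theorem\<close>, the orthogonal diagonalization of real symmetric
  matrices, proved by splitting off one eigenvector at a time.
\<close>

section \<open>Spectral theorem for real symmetric matrices\<close>

text \<open>
  If \<open>A v = a v\<close>, then \<open>v\<^sup>* A v = a (v\<^sup>* v)\<close>, where \<open>v\<^sup>* v > 0\<close> and symmetry of the real
  matrix \<open>A\<close> makes \<open>v\<^sup>* A v\<close> its own conjugate.
\<close>

lemma complex_eigenvalue_of_real_symmetric: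
  fixes A :: "real mat"
  assumes A: "A \<in> carrier_mat n n" and sym: "transpose_mat A = A"
    and ev: "eigenvalue (map_mat complex_of_real A) a"
  shows "a \<in> \<real>"
proof -
  let ?A = "map_mat complex_of_real A"
  obtain v where v: "v \<in> carrier_vec n" "v \<noteq> 0\<^sub>v n" and Av: "?A *\<^sub>v v = a \<cdot>\<^sub>v v"
    using ev A unfolding eigenvalue_def eigenvector_def by auto
  have entry: "(\<Sum>j<n. of_real (A $$ (i, j)) * v $ j) = a * v $ i" if "i < n" for i
    using arg_cong[OF Av, of "\<lambda>w. w $ i"] that A v(1)
    by (simp add: scalar_prod_def lessThan_atLeast0)
  have symE: "A $$ (i, j) = A $$ (j, i)" if "i < n" "j < n" for i j
    using arg_cong[OF sym, of "\<lambda>M. M $$ (i, j)"] that A by simp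
  define N where "N = (\<Sum>i<n. cnj (v $ i) * v $ i)"
  define Q where "Q = (\<Sum>i<n. \<Sum>j<n. cnj (v $ i) * of_real (A $$ (i, j)) * v $ j)"
  have "Q = (\<Sum>i<n. cnj (v $ i) * (\<Sum>j<n. of_real (A $$ (i, j)) * v $ j))"
    by (simp add: Q_def sum_distrib_left mult.assoc)
  also have "\<dots> = (\<Sum>i<n. cnj (v $ i) * (a * v $ i))"
    by (intro sum.cong refl) (simp add: entry)
  also have "\<dots> = a * N"
    by (simp add: N_def sum_distrib_left mult_ac)
  finally have Q: "Q = a * N" .
  have "cnj Q = (\<Sum>i<n. \<Sum>j<n. cnj (v $ j) * of_real (A $$ (i, j)) * v $ i)"
    by (simp add: Q_def mult_ac)
  also have "\<dots> = (\<Sum>j<n. \<Sum>i<n. cnj (v $ j) * of_real (A $$ (i, j)) * v $ i)"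
    by (rule sum.swap)
  also have "\<dots> = Q"
    unfolding Q_def by (intro sum.cong refl) (simp add: symE)
  finally have "cnj Q = Q" .
  have N: "N = of_real (\<Sum>i<n. (cmod (v $ i))\<^sup>2)"
    by (simp add: N_def complex_norm_square mult.commute del: of_real_power)
  moreover have "(\<Sum>i<n. (cmod (v $ i))\<^sup>2) \<noteq> 0"
  proof
    assume "(\<Sum>i<n. (cmod (v $ i))\<^sup>2) = 0"
    then have "\<forall>i<n. v $ i = 0"
      by (subst (asm) sum_nonneg_eq_0_iff) auto
    then have "v = 0\<^sub>v n" using v(1) by (intro eq_vecI) auto
    with v(2) show False ..
  qed
  ultimately have "N \<noteq> 0" by (simp only: of_real_eq_0_iff not_False_eq_True)
  then have "a = Q / N" using Q by simp
  moreover have "cnj N = N" unfolding N by (rule complex_cnj_complex_of_real)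
  ultimately have "cnj a = a" using \<open>cnj Q = Q\<close> by (simp only: complex_cnj_divide)
  then show ?thesis using Reals_cnj_iff by blast
qed

text \<open>
  The characteristic polynomial splits over the complex numbers, and its roots there are real, so
  the factorization descends to the reals.
\<close>

lemma real_symmetric_char_poly_splits:
  fixes A :: "real mat"
  assumes A: "A \<in> carrier_mat n n" and sym: "transpose_mat A = A"
  shows "\<exists>es. char_poly A = (\<Prod>e\<leftarrow>es. [:- e, 1:])"
proof -
  let ?A = "map_mat complex_of_real A"
  have A': "?A \<in> carrier_mat n n" using A by auto
  obtain as where as: "char_poly ?A = (\<Prod>a\<leftarrow>as. [:- a, 1:])"
    using char_poly_factorized[OF A'] by auto
  have real: "of_real (Re a) = a" if "a \<in> set as" for a
  proof -
    have "poly (char_poly ?A) a = 0"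
      unfolding as poly_prod_list using that by (auto simp: prod_list_zero_iff)
    then have "eigenvalue ?A a"
      using eigenvalue_root_char_poly[OF A'] by blast
    then show ?thesis
      using complex_eigenvalue_of_real_symmetric[OF A sym] of_real_Re by blast
  qed
  interpret map_poly_comm_ring_hom complex_of_real ..
  have "map_poly complex_of_real (char_poly A) = char_poly ?A"
    by (simp add: of_real_hom.char_poly_hom[OF A])
  also have "\<dots> = (\<Prod>a\<leftarrow>as. map_poly complex_of_real [:- Re a, 1:])"
    unfolding as by (rule arg_cong[of _ _ prod_list], rule map_cong) (simp_all add: real)
  also have "\<dots> = map_poly complex_of_real (\<Prod>e\<leftarrow>map Re as. [:- e, 1:])"
    by (simp add: hom_prod_list o_def)
  finally have "char_poly A = (\<Prod>e\<leftarrow>map Re as. [:- e, 1:])"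
    by (simp add: poly_eq_iff coeff_map_poly)
  then show ?thesis by blast
qed

text \<open>
  Gram-Schmidt, started from a basis whose first vector is an eigenvector, leaves this vector in
  first position; normalizing the result only rescales it.
\<close>

lemma orthogonal_matrix_with_eigenvector_column:
  fixes A :: "real mat"
  assumes A: "A \<in> carrier_mat n n" and e: "eigenvalue A e"
  shows "\<exists>W \<in> carrier_mat n n. transpose_mat W * W = 1\<^sub>m n \<and> A *\<^sub>v col W 0 = e \<cdot>\<^sub>v col W 0"
proof -
  obtain v where v: "v \<in> carrier_vec n" "v \<noteq> 0\<^sub>v n" and Av: "A *\<^sub>v v = e \<cdot>\<^sub>v v"
    using e A unfolding eigenvalue_def eigenvector_def by auto
  have n: "n \<noteq> 0" using v by (metis carrier_vecD eq_vecI index_zero_vec(2) less_nat_zero_code)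
  interpret cof_vec_space n "TYPE(real)" .
  define b where "b = basis_completion v"
  define ws where "ws = gram_schmidt n b"
  note bc = basis_completion[OF v, folded b_def]
  obtain vs where bv: "b = v # vs" using bc(6,7) n by (cases b) auto
  note gs = gram_schmidt_result[OF bc(2) bc(4) bc(5) ws_def]
  have len: "length ws = n" using gs(4) bc by simp
  have "hd ws = v" unfolding ws_def bv using v by simp
  then have ws0: "ws ! 0 = v" using len n by (metis hd_conv_nth length_0_conv)
  have wsc: "ws ! j \<in> carrier_vec n" if "j < n" for j
    using gs(3) len that by auto
  have orth: "(ws ! i \<bullet> ws ! j = 0) = (i \<noteq> j)" if "i < n" "j < n" for i j
    using corthogonalD[OF gs(2), of i j] that len by (simp add: conjugate_vec_def vec_eq_iff)
  define r where "r j = sqrt (ws ! j \<bullet> ws ! j)" for j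
  have r: "r j > 0" "r j * r j = ws ! j \<bullet> ws ! j" if "j < n" for j
  proof -
    have "ws ! j \<bullet> ws ! j \<ge> 0" unfolding scalar_prod_def by (intro sum_nonneg) auto
    with orth[OF that that] show "r j > 0" "r j * r j = ws ! j \<bullet> ws ! j"
      by (auto simp: r_def)
  qed
  define W where "W = mat_of_cols n (map (\<lambda>j. (1 / r j) \<cdot>\<^sub>v ws ! j) [0..<n])"
  have W: "W \<in> carrier_mat n n" by (auto simp: W_def)
  have colW: "col W j = (1 / r j) \<cdot>\<^sub>v ws ! j" if "j < n" for j
    unfolding W_def using that wsc[OF that] by (subst col_mat_of_cols) auto
  have "transpose_mat W * W = 1\<^sub>m n"
  proof (rule eq_matI)
    fix i j assume "i < dim_row (1\<^sub>m n)" "j < dim_col (1\<^sub>m n)"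
    then have ij: "i < n" "j < n" by auto
    have "(transpose_mat W * W) $$ (i, j) = (1 / r i) * (1 / r j) * (ws ! i \<bullet> ws ! j)"
      using W ij wsc[OF ij(1)] wsc[OF ij(2)] by (simp add: colW)
    also have "\<dots> = (if i = j then 1 else 0)"
      using orth[OF ij] r[OF ij(1)] by (auto simp: field_simps)
    finally show "(transpose_mat W * W) $$ (i, j) = 1\<^sub>m n $$ (i, j)"
      using ij by simp
  qed (use W in auto)
  moreover have "A *\<^sub>v col W 0 = e \<cdot>\<^sub>v col W 0"
    using n A v(1) Av ws0 by (simp add: colW mult_mat_vec smult_smult_assoc mult.commute)
  ultimately show ?thesis using W by blast
qed

text \<open>
  Orthogonal diagonalization, with the eigenvalues in any prescribed order; the order is what later
  singles out the largest ones.  With an eigenvector for the first eigenvalue as first column of an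
  orthogonal \<open>W\<close>, the first column of \<open>W\<^sup>T A W\<close> vanishes off the diagonal.  By symmetry so does the
  first row, and the remaining block is symmetric with the remaining eigenvalues.
\<close>

theorem real_spectral_theorem:
  fixes A :: "real mat"
  assumes "A \<in> carrier_mat n n" and "transpose_mat A = A"
    and "char_poly A = (\<Prod>e\<leftarrow>es. [:- e, 1:])"
  shows "\<exists>P \<in> carrier_mat n n. transpose_mat P * P = 1\<^sub>m n \<and>
    transpose_mat P * A * P = mat n n (\<lambda>(i, j). if i = j then es ! i else 0)"
  using assms
proof (induction es arbitrary: n A)
  case Nil
  then have "n = 0" using degree_monic_char_poly[of A n] by simp
  then show ?case by (intro bexI[of _ "1\<^sub>m 0"]) auto
next
  case (Cons e es)
  note A = Cons.prems(1) and sym = Cons.prems(2) and cp = Cons.prems(3)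
  define k where "k = n - 1"
  have "degree (char_poly A) = Suc (degree (\<Prod>e\<leftarrow>es. [:- e, 1:]))"
    unfolding cp list.map prod_list.Cons
    by (subst degree_mult_eq) (auto simp: prod_list_zero_iff)
  then have n: "n = Suc k" using degree_monic_char_poly[OF A] by (simp add: k_def)
  have "eigenvalue A e" unfolding eigenvalue_root_char_poly[OF A] cp by simp
  then obtain W where W: "W \<in> carrier_mat n n" and WW: "transpose_mat W * W = 1\<^sub>m n"
    and ev: "A *\<^sub>v col W 0 = e \<cdot>\<^sub>v col W 0"
    using orthogonal_matrix_with_eigenvector_column[OF A] by blast
  have WW': "W * transpose_mat W = 1\<^sub>m n"
    using mat_mult_left_right_inverse[OF _ W WW] W by auto
  define A' where "A' = transpose_mat W * A * W"
  have A': "A' \<in> carrier_mat n n" using A W by (simp add: A'_def)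
  have sym': "transpose_mat A' = A'"
    unfolding A'_def using A W sym
    by (simp add: transpose_mult[of _ n n _ n] assoc_mult_mat[of _ n n _ n _ n])
  have col0: "A' $$ (i, 0) = (if i = 0 then e else 0)" if i: "i < n" for i
  proof -
    have "A' $$ (i, 0) = col W i \<bullet> (A *\<^sub>v col W 0)"
      unfolding A'_def using i A W n 
      by (subst assoc_mult_mat[of _ n n _ n _ n]) (auto simp: mult_mat_vec_def)
    also have "\<dots> = e * (transpose_mat W * W) $$ (i, 0)"
      using i W n by (simp add: ev)
    finally show ?thesis using i n by (simp add: WW)
  qed
  have row0: "A' $$ (0, i) = (if i = 0 then e else 0)" if "i < n" for i
    using col0[OF that] that A' n arg_cong[OF sym', of "\<lambda>M. M $$ (0, i)"] by simp
  define B where "B = mat k k (\<lambda>(i, j). A' $$ (Suc i, Suc j))"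
  have B: "B \<in> carrier_mat k k" by (simp add: B_def)
  let ?E = "mat 1 1 (\<lambda>_. e)"
  have blk: "A' = four_block_mat ?E (0\<^sub>m 1 k) (0\<^sub>m k 1) B"
    by (rule eq_matI) (use A' n in \<open>auto simp: B_def col0 row0\<close>)
  have symB: "transpose_mat B = B"
  proof (rule eq_matI)
    fix i j assume "i < dim_row B" "j < dim_col B"
    then show "transpose_mat B $$ (i, j) = B $$ (i, j)"
      using arg_cong[OF sym', of "\<lambda>M. M $$ (Suc i, Suc j)"] A' n by (simp add: B_def)
  qed (simp_all add: B_def)
  have "similar_mat_wit A' A (transpose_mat W) W"
    by (rule similar_mat_witI[of _ _ n]) (use A A' W WW WW' in \<open>auto simp: A'_def\<close>)
  then have "char_poly A' = char_poly A"
    by (intro char_poly_similar) (auto simp: similar_mat_def)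
  moreover have "char_poly A' = char_poly ?E * char_poly B"
    unfolding blk by (rule char_poly_four_block_zeros_col) (use B in auto)
  moreover have "char_poly ?E = [:- e, 1:]"
    by (simp add: char_poly_defs det_def sign_def)
  ultimately have "[:- e, 1:] * char_poly B = [:- e, 1:] * (\<Prod>e\<leftarrow>es. [:- e, 1:])"
    using cp by simp
  then have cpB: "char_poly B = (\<Prod>e\<leftarrow>es. [:- e, 1:])"
    by (metis mult_cancel_left pCons_eq_0_iff zero_neq_one)
  obtain R where R: "R \<in> carrier_mat k k" and RR: "transpose_mat R * R = 1\<^sub>m k"
    and RBR: "transpose_mat R * B * R = mat k k (\<lambda>(i, j). if i = j then es ! i else 0)"
    using Cons.IH[OF B symB cpB] by blast
  define S where "S = four_block_mat (1\<^sub>m 1) (0\<^sub>m 1 k) (0\<^sub>m k 1) R"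
  have S: "S \<in> carrier_mat n n" using R n by (auto simp: S_def)
  have tS: "transpose_mat S = four_block_mat (1\<^sub>m 1) (0\<^sub>m 1 k) (0\<^sub>m k 1) (transpose_mat R)"
    unfolding S_def using R by (subst transpose_four_block_mat[of _ 1 1 _ k _ k]) auto
  have SS: "transpose_mat S * S = 1\<^sub>m n"
    unfolding tS unfolding S_def using R n
    by (subst mult_four_block_mat[of _ 1 1 _ k _ k _ _ 1 _ k]) (auto simp: RR)
  have "transpose_mat S * A' = four_block_mat ?E (0\<^sub>m 1 k) (0\<^sub>m k 1) (transpose_mat R * B)"
    unfolding tS blk using R B
    by (subst mult_four_block_mat[of _ 1 1 _ k _ k _ _ 1 _ k]) auto
  then have "transpose_mat S * A' * S =
      four_block_mat ?E (0\<^sub>m 1 k) (0\<^sub>m k 1) (transpose_mat R * B * R)"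
    unfolding S_def using R B
    by (simp, subst mult_four_block_mat[of _ 1 1 _ k _ k _ _ 1 _ k]) auto
  also have "\<dots> = mat n n (\<lambda>(i, j). if i = j then (e # es) ! i else 0)"
    unfolding RBR by (rule eq_matI) (use n in \<open>auto simp: nth_Cons'\<close>)
  finally have SAS: "transpose_mat S * A' * S = \<dots>" .
  have tWS: "transpose_mat (W * S) = transpose_mat S * transpose_mat W"
    using transpose_mult[OF W S] .
  have "transpose_mat (W * S) * (W * S) = transpose_mat S * (transpose_mat W * W) * S"
    unfolding tWS using W S by (simp add: assoc_mult_mat[of _ n n _ n _ n])
  also have "\<dots> = 1\<^sub>m n" using S by (simp add: WW SS)
  finally have "transpose_mat (W * S) * (W * S) = 1\<^sub>m n" .
  moreover have "transpose_mat (W * S) * A * (W * S) = transpose_mat S * A' * S"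
    unfolding tWS A'_def using W S A by (simp add: assoc_mult_mat[of _ n n _ n _ n])
  ultimately show ?case using W S SAS by (intro bexI[of _ "W * S"]) auto
qed

section \<open>Ky Fan's principle for projections\<close>

definition mat_trace :: "'a :: comm_monoid_add mat \<Rightarrow> 'a" where
  "mat_trace A = (\<Sum>i<dim_row A. A $$ (i, i))"

lemma mat_trace_mult:
  assumes "A \<in> carrier_mat n k" "B \<in> carrier_mat k n"
  shows "mat_trace (A * B) = (\<Sum>i<n. \<Sum>j<k. A $$ (i, j) * B $$ (j, i))"
  using assms by (simp add: mat_trace_def scalar_prod_def lessThan_atLeast0)

lemma mat_trace_commute:
  fixes A :: "'a :: comm_semiring_0 mat"
  assumes "A \<in> carrier_mat n k" "B \<in> carrier_mat k n"
  shows "mat_trace (A * B) = mat_trace (B * A)"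
  unfolding mat_trace_mult[OF assms] mat_trace_mult[OF assms(2,1)]
  by (subst sum.swap) (simp add: mult.commute)

text \<open>
  For \<open>m > 0\<close>, subtract \<open>t = es ! (m - 1)\<close> from every entry: entries at positions below \<open>m\<close> become nonnegative
  and count at most fully, the others become nonpositive and can be dropped.  Since the weights add
  up to \<open>m\<close>, both sides lose exactly \<open>m t\<close>.
\<close>

lemma weighted_sum_le_sum_of_largest:
  fixes es :: "real list" and c :: "nat \<Rightarrow> real"
  assumes sorted: "sorted_wrt (\<ge>) es" and m: "m \<le> length es"
    and c: "\<And>i. i < length es \<Longrightarrow> 0 \<le> c i \<and> c i \<le> 1"
    and sum: "(\<Sum>i<length es. c i) = real m"
  shows "(\<Sum>i<length es. es ! i * c i) \<le> (\<Sum>i<m. es ! i)"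
proof (cases "m = 0")
  case True
  then have "\<forall>i\<in>{..<length es}. c i = 0"
    using sum c by (subst sum_nonneg_eq_0_iff[symmetric]) auto
  then show ?thesis using True by simp
next
  case False
  let ?n = "length es" and ?t = "es ! (m - 1)"
  have mono: "es ! j \<le> es ! i" if "i \<le> j" "j < ?n" for i j
    using sorted that by (cases "i = j") (auto simp: sorted_wrt_iff_nth_less)
  have "(\<Sum>i<?n. (es ! i - ?t) * c i) \<le> (\<Sum>i<?n. if i < m then es ! i - ?t else 0)"
  proof (rule sum_mono)
    fix i assume i: "i \<in> {..<?n}"
    show "(es ! i - ?t) * c i \<le> (if i < m then es ! i - ?t else 0)"
    proof (cases "i < m")
      case True
      then have "0 \<le> es ! i - ?t" using mono[of i "m - 1"] m by auto
      then show ?thesis using True i c[of i] by (auto intro: mult_left_le)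
    next
      case le: False
      then have "es ! i - ?t \<le> 0" using mono[of "m - 1" i] i by auto
      then show ?thesis using le i c[of i] by (auto intro: mult_nonpos_nonneg)
    qed
  qed
  also have "\<dots> = (\<Sum>i<m. es ! i - ?t)"
    by (rule sum.mono_neutral_cong_right) (use m in auto)
  also have "\<dots> = (\<Sum>i<m. es ! i) - real m * ?t"
    by (simp only: sum_subtractf sum_constant card_lessThan)
  finally have "(\<Sum>i<?n. (es ! i - ?t) * c i) \<le> (\<Sum>i<m. es ! i) - real m * ?t" .
  moreover have "(\<Sum>i<?n. (es ! i - ?t) * c i) = (\<Sum>i<?n. es ! i * c i) - ?t * real m"
    by (simp only: left_diff_distrib sum_subtractf sum flip: sum_distrib_left)
  ultimately show ?thesis by (simp add: mult.commute)
qed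

text \<open>
  Ky Fan's maximum principle for orthogonal projections.  In an orthonormal eigenbasis of \<open>A\<close> the
  trace of \<open>A X\<close> is the sum of the eigenvalues weighted by the diagonal of \<open>Y = P\<^sup>T X P\<close>.  As \<open>Y\<close>
  is again a symmetric idempotent, its diagonal entries satisfy
  \<open>y\<^sub>i\<^sub>i = (\<Sum>j. y\<^sub>i\<^sub>j\<^sup>2) \<ge> y\<^sub>i\<^sub>i\<^sup>2\<close> and hence lie in the unit interval.
\<close>

theorem ky_fan_projection_trace_le:
  fixes A X :: "real mat"
  assumes A: "A \<in> carrier_mat n n" and symA: "transpose_mat A = A"
    and cp: "char_poly A = (\<Prod>e\<leftarrow>es. [:- e, 1:])" and sorted: "sorted_wrt (\<ge>) es"
    and X: "X \<in> carrier_mat n n" and symX: "transpose_mat X = X" and idem: "X * X = X"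
    and tr: "mat_trace X = real m" 
  shows "mat_trace (A * X) \<le> (\<Sum>i<m. es ! i)"
proof -
  obtain P where P: "P \<in> carrier_mat n n" and PP: "transpose_mat P * P = 1\<^sub>m n"
    and PAP: "transpose_mat P * A * P = mat n n (\<lambda>(i, j). if i = j then es ! i else 0)"
    using real_spectral_theorem[OF A symA cp] by blast
  have PP': "P * transpose_mat P = 1\<^sub>m n"
    using mat_mult_left_right_inverse[OF _ P PP] P by auto
  have len: "length es = n"
    using degree_monic_char_poly[OF A] degree_linear_factors[of uminus es] cp by simp
  define Y where "Y = transpose_mat P * X * P"
  have Y: "Y \<in> carrier_mat n n" using P X by (simp add: Y_def)
  have conj: "transpose_mat P * M * P * (transpose_mat P * N * P) = transpose_mat P * (M * N) * P"
    if "M \<in> carrier_mat n n" "N \<in> carrier_mat n n" for M N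
  proof -
    have "transpose_mat P * M * P * (transpose_mat P * N * P) =
        transpose_mat P * M * (P * transpose_mat P) * N * P"
      using P that by (simp add: assoc_mult_mat[of _ n n _ n _ n])
    then show ?thesis using P that by (simp add: PP' assoc_mult_mat[of _ n n _ n _ n])
  qed
  have tr_conj: "mat_trace (transpose_mat P * M * P) = mat_trace M" if "M \<in> carrier_mat n n" for M
  proof -
    have "mat_trace (transpose_mat P * M * P) = mat_trace (P * (transpose_mat P * M))"
      by (rule mat_trace_commute[of _ n n]) (use P that in auto)
    also have "P * (transpose_mat P * M) = M"
      using P that PP' by (simp flip: assoc_mult_mat[of _ n n _ n _ n])
    finally show ?thesis .
  qed
  have symY: "transpose_mat Y = Y"
    unfolding Y_def using P X symX
    by (simp add: transpose_mult[of _ n n _ n] assoc_mult_mat[of _ n n _ n _ n])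
  have YY: "Y * Y = Y" unfolding Y_def conj[OF X X] idem ..
  have c: "0 \<le> Y $$ (i, i) \<and> Y $$ (i, i) \<le> 1" if i: "i < n" for i
  proof -
    have "Y $$ (j, i) = Y $$ (i, j)" if "j < n" for j
      using arg_cong[OF symY, of "\<lambda>M. M $$ (i, j)"] Y i that by simp
    moreover have "Y $$ (i, i) = (\<Sum>j<n. Y $$ (i, j) * Y $$ (j, i))"
      using arg_cong[OF YY, of "\<lambda>M. M $$ (i, i)"] Y i
      by (simp add: scalar_prod_def lessThan_atLeast0)
    ultimately have eq: "Y $$ (i, i) = (\<Sum>j<n. (Y $$ (i, j))\<^sup>2)"
      by (simp add: power2_eq_square)
    moreover have "(Y $$ (i, i))\<^sup>2 \<le> (\<Sum>j<n. (Y $$ (i, j))\<^sup>2)"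
      using i by (intro member_le_sum) auto
    ultimately have "(Y $$ (i, i))\<^sup>2 \<le> Y $$ (i, i)" by simp
    then have "Y $$ (i, i) \<le> 1"
      using mult_strict_left_mono[of 1 "Y $$ (i, i)" "Y $$ (i, i)"]
      unfolding power2_eq_square by linarith
    moreover have "0 \<le> Y $$ (i, i)" unfolding eq by (intro sum_nonneg) auto
    ultimately show ?thesis by blast
  qed
  have trY: "(\<Sum>i<n. Y $$ (i, i)) = real m"
    using tr_conj[OF X] tr Y by (simp add: Y_def[symmetric] mat_trace_def)
  have "real m \<le> real n"
    using sum_bounded_above[of "{..<n}" "\<lambda>i. Y $$ (i, i)" 1] c trY by simp
  then have m: "m \<le> length es" using len by simp
  have "mat_trace (A * X) = mat_trace (transpose_mat P * A * P * Y)"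
    unfolding Y_def conj[OF A X] by (rule tr_conj[symmetric]) (use A X in auto)
  also have "\<dots> = (\<Sum>i<n. \<Sum>j<n. (if i = j then es ! i else 0) * Y $$ (j, i))"
    unfolding PAP by (subst mat_trace_mult[OF _ Y]) auto
  also have "\<dots> = (\<Sum>i<n. es ! i * Y $$ (i, i))"
    by (simp add: if_distrib[of "\<lambda>x. x * _"] cong: if_cong)
  also have "\<dots> \<le> (\<Sum>i<m. es ! i)"
    using weighted_sum_le_sum_of_largest[OF sorted m, of "\<lambda>i. Y $$ (i, i)"] unfolding len
    using c trY by blast
  finally show ?thesis .
qed

section \<open>Projection onto zero-sum vectors constant off a set\<close>

text \<open>
  For \<open>I \<subset> {0..<n}\<close> this is the orthogonal projection of \<open>\<real>\<^sup>n\<close> onto the vectors with coordinate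
  sum 0 that are constant outside \<open>I\<close>: the projection onto the span of the unit vectors \<open>e\<^sub>i\<close> with
  \<open>i \<in> I\<close> and the indicator vector of the complement, minus the projection onto the constants.
\<close>

definition zero_sum_projection :: "nat \<Rightarrow> nat set \<Rightarrow> real mat" where
  "zero_sum_projection n I = mat n n (\<lambda>(i, j).
     of_bool (i = j \<and> i \<in> I) + of_bool (i \<notin> I \<and> j \<notin> I) / real (n - card I) - 1 / real n)"

lemma zero_sum_projection_carrier [simp]:
  "zero_sum_projection n I \<in> carrier_mat n n"
  by (simp add: zero_sum_projection_def)

lemma transpose_zero_sum_projection:
  "transpose_mat (zero_sum_projection n I) = zero_sum_projection n I"
  by (rule eq_matI) (auto simp: zero_sum_projection_def conj_commute)

lemma sum_of_bool_mult_real: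
  fixes f :: "nat \<Rightarrow> real"
  assumes "I \<subseteq> {..<n}"
  shows "(\<Sum>i<n. of_bool (i \<in> I) * f i) = (\<Sum>i\<in>I. f i)"
    and "(\<Sum>i<n. of_bool (i \<notin> I) * f i) = (\<Sum>i\<in>{..<n} - I. f i)"
  using assms by (auto intro!: sum.mono_neutral_cong_right simp: of_bool_def)

lemma mat_trace_zero_sum_projection:
  assumes I: "I \<subseteq> {..<n}" "card I < n"
  shows "mat_trace (zero_sum_projection n I) = real (card I)"
proof -
  have fin: "finite I" using I by (auto intro: finite_subset)
  have cc: "card ({..<n} - I) = n - card I" using I fin by (simp add: card_Diff_subset)
  have "mat_trace (zero_sum_projection n I) =
      (\<Sum>i<n. of_bool (i \<in> I) * 1 + of_bool (i \<notin> I) * (1 / real (n - card I)) - 1 / real n)"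
    by (simp add: mat_trace_def zero_sum_projection_def)
  also have "\<dots> = real (card I) + 1 - 1"
    using I unfolding sum_subtractf sum.distrib sum_of_bool_mult_real[OF I(1)]
    by (simp add: cc)
  finally show ?thesis by simp
qed

lemma zero_sum_projection_idempotent:
  assumes I: "I \<subseteq> {..<n}" "card I < n"
  shows "zero_sum_projection n I * zero_sum_projection n I =
    zero_sum_projection n I" (is "?X * ?X = ?X")
proof (rule eq_matI)
  fix i j assume "i < dim_row ?X" "j < dim_col ?X"
  then have i: "i < n" and j: "j < n" by (auto simp: zero_sum_projection_def)
  have fin: "finite I" using I by (auto intro: finite_subset)
  have cc: "card ({..<n} - I) = n - card I" using I fin by (simp add: card_Diff_subset)
  \<comment> \<open>In terms of the indicator \<open>f\<close> of the complement, row \<open>i\<close> of \<open>X\<close> combines \<open>e\<^sub>i\<close>, \<open>f\<close> and \<open>1\<close>, so an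
    entry of \<open>X * X\<close> only needs the sums of a column of \<open>X\<close> against \<open>1\<close> and against \<open>f\<close>.\<close>
  define a b where "a = 1 / real (n - card I)" and "b = 1 / real n"
  define f where "f i = (of_bool (i \<notin> I) :: real)" for i
  have ab: "a * real (n - card I) = 1" "b * real n = 1" using I by (auto simp: a_def b_def)
  have entry: "?X $$ (p, q) = of_bool (p = q) * (1 - f p) + a * f p * f q - b"
    if "p < n" "q < n" for p q
    using that by (auto simp: zero_sum_projection_def a_def b_def f_def)
  have sumf: "(\<Sum>k<n. f k) = real (n - card I)"
    using sum_of_bool_mult_real(2)[OF I(1), of "\<lambda>_. 1"] cc by (simp add: f_def)
  have col: "(\<Sum>k<n. ?X $$ (k, j)) = 0"
  proof -
    have "(\<Sum>k<n. ?X $$ (k, j)) = (\<Sum>k<n. of_bool (k = j) * (1 - f k) + (a * f j) * f k - b)"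
      using j by (intro sum.cong) (auto simp: entry)
    also have "\<dots> = (1 - f j) + (a * f j) * real (n - card I) - real n * b"
      using j by (simp add: sum_subtractf sum.distrib sumf flip: sum_distrib_left)
    also have "\<dots> = (1 - f j) + (a * real (n - card I)) * f j - b * real n"
      by (simp add: algebra_simps)
    finally show ?thesis by (simp add: ab)
  qed
  have colf: "(\<Sum>k<n. f k * ?X $$ (k, j)) = f j - b * real (n - card I)"
  proof -
    have "(\<Sum>k<n. f k * ?X $$ (k, j)) = (\<Sum>k<n. (a * f j - b) * f k)"
    proof (intro sum.cong refl)
      fix k assume "k \<in> {..<n}"
      then show "f k * ?X $$ (k, j) = (a * f j - b) * f k"
        using j by (subst entry) (auto simp: f_def)
    qed
    also have "\<dots> = (a * f j - b) * real (n - card I)"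
      by (simp add: sumf flip: sum_distrib_left)
    also have "\<dots> = (a * real (n - card I)) * f j - b * real (n - card I)"
      by (simp add: algebra_simps)
    finally show ?thesis by (simp add: ab)
  qed
  have "(?X * ?X) $$ (i, j) = (\<Sum>k<n. ?X $$ (i, k) * ?X $$ (k, j))"
    using i j by (simp add: times_mat_def scalar_prod_def lessThan_atLeast0 zero_sum_projection_def)
  also have "\<dots> = (\<Sum>k<n. of_bool (i = k) * ((1 - f i) * ?X $$ (i, j)) +
      (a * f i) * (f k * ?X $$ (k, j)) - b * ?X $$ (k, j))"
    using i by (intro sum.cong) (auto simp: entry[of i] algebra_simps)
  also have "\<dots> = (1 - f i) * ?X $$ (i, j) + (a * f i) * (f j - b * real (n - card I)) - b * 0"
    using i by (simp add: sum_subtractf sum.distrib colf col flip: sum_distrib_left)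
  also have "\<dots> = (1 - f i) * ?X $$ (i, j) + a * f i * f j - (a * real (n - card I)) * b * f i"
    by (simp add: algebra_simps)
  also have "\<dots> = ?X $$ (i, j)"
    using i j by (auto simp: ab entry f_def)
  finally show "(?X * ?X) $$ (i, j) = ?X $$ (i, j)" .
qed (auto simp: zero_sum_projection_def)

text \<open>
  The rank-one term of the projection that removes the constants contributes nothing, because \<open>L\<close>
  annihilates constant vectors.  For the same reason the entries of a row over the complement of \<open>I\<close>
  sum to minus those over \<open>I\<close>.
\<close>

lemma mat_trace_mult_zero_sum_projection:
  assumes L: "L \<in> carrier_mat n n" and rows: "\<And>i. i < n \<Longrightarrow> (\<Sum>j<n. L $$ (i, j)) = 0"
    and I: "I \<subseteq> {..<n}"
  shows "mat_trace (L * zero_sum_projection n I) =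
    (\<Sum>i\<in>I. L $$ (i, i)) + (\<Sum>i\<in>{..<n} - I. \<Sum>j\<in>I. - L $$ (i, j)) / real (n - card I)"
proof -
  define a b where "a = 1 / real (n - card I)" and "b = 1 / real n"
  have fin: "finite I" using I by (auto intro: finite_subset)
  have row: "(\<Sum>j<n. L $$ (i, j) * zero_sum_projection n I $$ (j, i)) =
      of_bool (i \<in> I) * L $$ (i, i) + of_bool (i \<notin> I) * (a * (\<Sum>j\<in>I. - L $$ (i, j)))"
    if i: "i < n" for i
  proof -
    have "(\<Sum>j<n. L $$ (i, j) * zero_sum_projection n I $$ (j, i)) =
        (\<Sum>j<n. of_bool (j = i) * (of_bool (i \<in> I) * L $$ (i, i)) +
           of_bool (i \<notin> I) * a * (of_bool (j \<notin> I) * L $$ (i, j)) - b * L $$ (i, j))"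
      using i by (intro sum.cong) (auto simp: zero_sum_projection_def a_def b_def algebra_simps)
    also have "\<dots> = of_bool (i \<in> I) * L $$ (i, i) +
        of_bool (i \<notin> I) * a * (\<Sum>j\<in>{..<n} - I. L $$ (i, j))"
      using i by (simp add: sum_subtractf sum.distrib rows sum_of_bool_mult_real[OF I] flip: sum_distrib_left)
    also have "(\<Sum>j\<in>{..<n} - I. L $$ (i, j)) = (\<Sum>j\<in>I. - L $$ (i, j))"
      using rows[OF i] I by (simp add: sum_diff sum_negf)
    finally show ?thesis by simp
  qed
  have "mat_trace (L * zero_sum_projection n I) =
      (\<Sum>i<n. of_bool (i \<in> I) * L $$ (i, i) + of_bool (i \<notin> I) * (a * (\<Sum>j\<in>I. - L $$ (i, j))))"
    by (subst mat_trace_mult[OF L zero_sum_projection_carrier]) (simp add: row)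
  also have "\<dots> = (\<Sum>i\<in>I. L $$ (i, i)) + a * (\<Sum>i\<in>{..<n} - I. \<Sum>j\<in>I. - L $$ (i, j))"
    unfolding sum.distrib sum_of_bool_mult_real[OF I] by (simp only: sum_distrib_left)
  finally show ?thesis by (simp add: a_def)
qed

lemma proots_prod_linear_factors:
  "proots (\<Prod>e\<leftarrow>es. [:- e, 1 :: 'a :: idom:]) = mset es"
proof (induction es)
  case (Cons e es)
  have "(\<Prod>e\<leftarrow>es. [:- e, 1:]) \<noteq> 0" by auto
  with Cons show ?case unfolding list.map prod_list.Cons
    by (subst proots_mult) simp_all
qed simp

text \<open>
  For a weighted Laplacian matrix \<open>L\<close> the double sum is the weight of the cut between \<open>I\<close> and its
  complement.  The inequality is Ky Fan's principle for the zero-sum projection, whose rank is only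
  \<open>card I\<close> although the trace against \<open>L\<close> sees \<open>card I + 1\<close> directions.
\<close>

theorem largest_eigenvalues_ge_diagonal_plus_cut:
  fixes L :: "real mat"
  assumes L: "L \<in> carrier_mat n n" and sym: "transpose_mat L = L"
    and rows: "\<And>i. i < n \<Longrightarrow> (\<Sum>j<n. L $$ (i, j)) = 0"
    and I: "I \<subseteq> {..<n}" "card I < n"
  shows "(\<Sum>i\<in>I. L $$ (i, i)) + (\<Sum>i\<in>{..<n} - I. \<Sum>j\<in>I. - L $$ (i, j)) / real (n - card I)
    \<le> (\<Sum>i<card I. rev (sorted_list_of_multiset (proots (char_poly L))) ! i)"
proof -
  let ?es = "rev (sorted_list_of_multiset (proots (char_poly L)))"
  obtain es where es: "char_poly L = (\<Prod>e\<leftarrow>es. [:- e, 1:])"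
    using real_symmetric_char_poly_splits[OF L sym] by blast
  have "mset ?es = mset es" by (simp add: es proots_prod_linear_factors)
  then have "mset (map (\<lambda>e. [:- e, 1:]) ?es) = mset (map (\<lambda>e. [:- e, 1:]) es)"
    by (simp only: mset_map)
  then have cp: "char_poly L = (\<Prod>e\<leftarrow>?es. [:- e, 1:])"
    unfolding es by (metis prod_mset_prod_list)
  have "sorted_wrt (\<ge>) ?es"
    using sorted_sorted_list_of_multiset by (simp add: sorted_wrt_rev)
  from ky_fan_projection_trace_le[OF L sym cp this zero_sum_projection_carrier
      transpose_zero_sum_projection zero_sum_projection_idempotent[OF I]
      mat_trace_zero_sum_projection[OF I]]
  show ?thesis by (simp only: mat_trace_mult_zero_sum_projection[OF L rows I(1)])
qed

section \<open>Cuts and degrees in a graph\<close>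

lemma (in digraph) out_degree_eq_sum_adjacency:
  "real (out_degree G v) = (\<Sum>w\<in>verts G. of_bool (v \<rightarrow>\<^bsub>G\<^esub> w))"
proof -
  have "inj_on (head G) (out_arcs G v)"
    by (rule inj_onI) (auto simp: out_arcs_def arc_to_ends_def intro!: no_multi_arcs)
  moreover have "head G ` out_arcs G v = {w \<in> verts G. v \<rightarrow>\<^bsub>G\<^esub> w}"
    by (auto simp: out_arcs_def arcs_ends_conv)
  ultimately have "out_degree G v = card {w \<in> verts G. v \<rightarrow>\<^bsub>G\<^esub> w}"
    unfolding out_degree_def by (metis card_image)
  then show ?thesis by (simp add: Int_def)
qed

lemma (in fin_digraph) edge_connectivity_le_card_cut:
  assumes "U \<subseteq> verts G" "0 < card U" "card U < card (verts G)"
  shows "edge_connectivity G \<le> card (cut G U)"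
  unfolding edge_connectivity_def
proof (rule Min_le)
  have "{card (cut G U) | U. U \<subseteq> verts G \<and> 0 < card U \<and> card U < card (verts G)}
      \<subseteq> (\<lambda>U. card (cut G U)) ` Pow (verts G)" by auto
  then show "finite {card (cut G U) | U. U \<subseteq> verts G \<and> 0 < card U \<and> card U < card (verts G)}"
    by (rule finite_subset) simp
qed (use assms in blast)

lemma (in fin_digraph) card_cut_le_sum_adjacency:
  assumes "U \<subseteq> verts G"
  shows "real (card (cut G U)) \<le> (\<Sum>v\<in>verts G - U. \<Sum>u\<in>U. of_bool (u \<rightarrow>\<^bsub>G\<^esub> v))"
proof -
  let ?S = "SIGMA v:verts G - U. {u \<in> U. u \<rightarrow>\<^bsub>G\<^esub> v}"
  have fin: "finite U" using assms finite_verts by (rule finite_subset)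
  have "cut G U \<subseteq> (\<lambda>(v, u). {u, v}) ` ?S"
  proof
    fix e assume "e \<in> cut G U"
    then obtain u v where e: "e = {u, v}" and "u \<in> U" "v \<in> verts G - U" "u \<rightarrow>\<^bsub>G\<^esub> v"
      unfolding cut_def by blast
    then have "(v, u) \<in> ?S" by blast
    then show "e \<in> (\<lambda>(v, u). {u, v}) ` ?S" by (rule rev_image_eqI) (simp add: e)
  qed
  then have "card (cut G U) \<le> card ?S"
    using fin by (intro surj_card_le) auto
  also have "card ?S = (\<Sum>v\<in>verts G - U. card {u \<in> U. u \<rightarrow>\<^bsub>G\<^esub> v})"
    using fin by simp
  finally show ?thesis using fin by (simp add: Int_def flip: of_nat_sum)
qed

lemma set_of_vertices_with_largest_degrees:
  fixes G :: "('a, 'b) pre_digraph"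
  assumes fin: "finite (verts G)" and m: "m \<le> card (verts G)"
  shows "\<exists>U \<subseteq> verts G. card U = m \<and> (\<Sum>u\<in>U. out_degree G u) = (\<Sum>i<m. degree_sequence G ! i)"
proof -
  obtain vs where vs: "set vs = verts G" "distinct vs"
    using finite_distinct_list[OF fin] by blast
  define ws where "ws = rev (sort_key (out_degree G) vs)"
  have ws: "set ws = verts G" "distinct ws" using vs by (simp_all add: ws_def)
  have len: "length ws = card (verts G)" using ws by (metis distinct_card)
  have "mset_set (verts G) = mset vs" using vs by (metis mset_set_set)
  moreover have "sort (map (out_degree G) vs) = map (out_degree G) (sort_key (out_degree G) vs)"
    by (rule properties_for_sort) simp_all
  ultimately have seq: "degree_sequence G = map (out_degree G) ws"
    unfolding degree_sequence_def ws_def by (simp add: rev_map flip: mset_map)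
  have "(\<Sum>u\<in>set (take m ws). out_degree G u) = sum_list (map (out_degree G) (take m ws))"
    using ws(2) by (simp add: sum_list_distinct_conv_sum_set)
  also have "\<dots> = (\<Sum>i<m. degree_sequence G ! i)"
    using m len unfolding seq sum_list_sum_nth by (intro sum.cong) auto
  finally show ?thesis
    using ws m len set_take_subset[of m ws]
    by (intro exI[of _ "set (take m ws)"]) (simp add: distinct_card)
qed

text \<open>
  The spectral inequality for the Laplacian matrix, with positions in \<open>vs\<close> translated to vertices.
\<close>

theorem (in graph) card_cut_le_laplacian_eigenvalues:
  assumes vs: "distinct vs" "set vs = verts G"
    and U: "U \<subseteq> verts G" "card U < card (verts G)"
  shows "real (card (cut G U)) \<le> real (card (verts G) - card U) *
    ((\<Sum>i<card U. laplacian_eigenvalues G vs ! i) - (\<Sum>u\<in>U. real (out_degree G u)))"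
proof -
  let ?n = "length vs" and ?L = "laplacian_matrix G vs"
  define I where "I = {i. i < ?n \<and> vs ! i \<in> U}"
  have n: "?n = card (verts G)" using vs by (metis distinct_card)
  have bij: "bij_betw ((!) vs) {..<?n} (verts G)"
    using bij_betw_nth[OF vs(1) refl vs(2)[symmetric]] .
  have bijS: "bij_betw ((!) vs) {i. i < ?n \<and> vs ! i \<in> S} S" if "S \<subseteq> verts G" for S
  proof (rule bij_betw_subset[OF bij])
    show "(!) vs ` {i. i < ?n \<and> vs ! i \<in> S} = S"
    proof (intro equalityI subsetI)
      fix v assume v: "v \<in> S"
      then have "v \<in> set vs" using that vs(2) by (simp only: subsetD)
      then obtain i where "i < ?n" "v = vs ! i" by (metis in_set_conv_nth)
      with v show "v \<in> (!) vs ` {i. i < ?n \<and> vs ! i \<in> S}" by (intro image_eqI[of _ _ i]) simp_all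
    next
      fix v assume "v \<in> (!) vs ` {i. i < ?n \<and> vs ! i \<in> S}"
      then show "v \<in> S" by (elim imageE) simp
    qed
  qed (simp add: subset_eq)
  have bijI: "bij_betw ((!) vs) I U"
    unfolding I_def by (rule bijS[OF U(1)])
  have "{..<?n} - I = {i. i < ?n \<and> vs ! i \<in> verts G - U}"
  proof (intro equalityI subsetI)
    fix i assume i: "i \<in> {..<?n} - I"
    then have "vs ! i \<in> verts G" using nth_mem[of i vs] vs(2) by simp
    with i show "i \<in> {i. i < ?n \<and> vs ! i \<in> verts G - U}" by (simp add: I_def)
  qed (simp add: I_def)
  then have bijJ: "bij_betw ((!) vs) ({..<?n} - I) (verts G - U)"
    using bijS[OF Diff_subset] by (simp only:)
  have I: "I \<subseteq> {..<?n}" "card I = card U"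
    using bij_betw_same_card[OF bijI] by (simp_all add: I_def subset_eq)
  have L: "?L \<in> carrier_mat ?n ?n"
    unfolding laplacian_matrix_def adjacency_matrix_def by (rule minus_carrier_mat) simp
  have entry: "?L $$ (i, j) = of_bool (i = j) * real (out_degree G (vs ! i)) - of_bool (vs ! i \<rightarrow>\<^bsub>G\<^esub> vs ! j)"
    if "i < ?n" "j < ?n" for i j
    using that by (simp add: laplacian_matrix_def degree_matrix_def adjacency_matrix_def)
  have adj_sym: "(u \<rightarrow>\<^bsub>G\<^esub> v) = (v \<rightarrow>\<^bsub>G\<^esub> u)" for u v
    using sym_arcs by (auto simp: symmetric_def dest: symD)
  have sym: "transpose_mat ?L = ?L"
    by (rule eq_matI) (use L in \<open>auto simp: entry adj_sym\<close>)
  have rows: "(\<Sum>j<?n. ?L $$ (i, j)) = 0" if "i < ?n" for i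
  proof -
    have "(\<Sum>j<?n. of_bool (vs ! i \<rightarrow>\<^bsub>G\<^esub> vs ! j)) = real (out_degree G (vs ! i))"
      unfolding out_degree_eq_sum_adjacency by (rule sum.reindex_bij_betw[OF bij])
    then show ?thesis using that by (simp add: entry sum_subtractf)
  qed
  have diag: "(\<Sum>i\<in>I. ?L $$ (i, i)) = (\<Sum>u\<in>U. real (out_degree G u))"
  proof -
    have "(\<Sum>i\<in>I. ?L $$ (i, i)) = (\<Sum>i\<in>I. real (out_degree G (vs ! i)))"
      using adj_not_same by (intro sum.cong) (auto simp: I_def entry)
    also have "\<dots> = (\<Sum>u\<in>U. real (out_degree G u))"
      by (rule sum.reindex_bij_betw[OF bijI])
    finally show ?thesis .
  qed
  have off: "(\<Sum>i\<in>{..<?n} - I. \<Sum>j\<in>I. - ?L $$ (i, j)) = (\<Sum>v\<in>verts G - U. \<Sum>u\<in>U. of_bool (u \<rightarrow>\<^bsub>G\<^esub> v))"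
  proof -
    have "(\<Sum>i\<in>{..<?n} - I. \<Sum>j\<in>I. - ?L $$ (i, j)) =
        (\<Sum>i\<in>{..<?n} - I. \<Sum>j\<in>I. of_bool (vs ! j \<rightarrow>\<^bsub>G\<^esub> vs ! i))"
      by (intro sum.cong refl) (auto simp: I_def entry adj_sym)
    also have "\<dots> = (\<Sum>i\<in>{..<?n} - I. \<Sum>u\<in>U. of_bool (u \<rightarrow>\<^bsub>G\<^esub> vs ! i))"
      by (intro sum.cong refl sum.reindex_bij_betw[OF bijI])
    also have "\<dots> = (\<Sum>v\<in>verts G - U. \<Sum>u\<in>U. of_bool (u \<rightarrow>\<^bsub>G\<^esub> v))"
      by (rule sum.reindex_bij_betw[OF bijJ])
    finally show ?thesis .
  qed
  have "card I < ?n" using U n I by simp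
  from largest_eigenvalues_ge_diagonal_plus_cut[OF L sym rows I(1) this]
  have "(\<Sum>u\<in>U. real (out_degree G u)) +
      (\<Sum>v\<in>verts G - U. \<Sum>u\<in>U. of_bool (u \<rightarrow>\<^bsub>G\<^esub> v)) / real (card (verts G) - card U)
      \<le> (\<Sum>i<card U. laplacian_eigenvalues G vs ! i)"
    unfolding diag off I(2) laplacian_eigenvalues_def unfolding n .
  then have "(\<Sum>v\<in>verts G - U. \<Sum>u\<in>U. of_bool (u \<rightarrow>\<^bsub>G\<^esub> v)) \<le> real (card (verts G) - card U) *
      ((\<Sum>i<card U. laplacian_eigenvalues G vs ! i) - (\<Sum>u\<in>U. real (out_degree G u)))"
    using U(2) by (simp add: field_simps)
  with card_cut_le_sum_adjacency[OF U(1)] show ?thesis by linarith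
qed

theorem proposition4p1:
  fixes G :: "('a, 'b) pre_digraph" and vs :: "'a list" and n :: nat
  assumes "graph G"
    and "connected G"
    and "card (verts G) = n"
    and "n \<ge> 2"
    and "distinct vs"
    and "set vs = verts G"
  shows "real (edge_connectivity G) \<le>
    (MIN m\<in>{0<..<n}. real (n - m) *
       (\<Sum>i = 1..m. laplacian_eigenvalues G vs ! (i - 1) - real (degree_sequence G ! (i - 1))))"
proof -
  interpret graph G by fact
  have "real (edge_connectivity G) \<le> real (n - m) *
      (\<Sum>i = 1..m. laplacian_eigenvalues G vs ! (i - 1) - real (degree_sequence G ! (i - 1)))"
    if m: "m \<in> {0<..<n}" for m
  proof -
    obtain U where U: "U \<subseteq> verts G" "card U = m"
      and deg: "(\<Sum>u\<in>U. out_degree G u) = (\<Sum>i<m. degree_sequence G ! i)"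
      using set_of_vertices_with_largest_degrees[OF finite_verts, of m] m assms(3) by auto
    have "real (edge_connectivity G) \<le> real (card (cut G U))"
      using edge_connectivity_le_card_cut[of U] U m assms(3) by simp
    also have "\<dots> \<le> real (n - m) *
        ((\<Sum>i<m. laplacian_eigenvalues G vs ! i) - (\<Sum>u\<in>U. real (out_degree G u)))"
      using card_cut_le_laplacian_eigenvalues[OF assms(5,6) U(1)] U m assms(3) by simp
    also have "(\<Sum>u\<in>U. real (out_degree G u)) = (\<Sum>i<m. real (degree_sequence G ! i))"
      using deg by (simp flip: of_nat_sum)
    also have "(\<Sum>i<m. laplacian_eigenvalues G vs ! i) - (\<Sum>i<m. real (degree_sequence G ! i)) =
        (\<Sum>i = 1..m. laplacian_eigenvalues G vs ! (i - 1) - real (degree_sequence G ! (i - 1)))"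
      by (simp add: sum_subtractf sum.atLeast1_atMost_eq)
    finally show ?thesis .
  qed
  moreover have "{0<..<n} \<noteq> {}" using assms(4) by (auto simp: set_eq_iff intro!: exI[of _ 1])
  ultimately show ?thesis by (subst Min_ge_iff) auto
qed

end
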